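(* If $\varphi:\mathbb{C}\to\mathbb{C}$ is a polynomial, then the superposition operator $S_\varphi:\mathcal{H}_+\to\mathcal{H}_+$ is well defined.
   Context: $\mathcal{H}_{+}$ is the space of Dirichlet series $D=\sum a_nn^{-s}$ with $\sum_n|a_n|^2n^{-2\sigma}<\infty$ for every $\sigma>0$; such series converge absolutely on $\mathbb{C}_{\frac12}=\{s\in\mathbb C:\operatorname{Re}s>\frac12\}$. The superposition operator with symbol $\varphi$ is $S_\varphi(D)=\varphi\circ D$; it is well defined $\mathcal{H}_+\to\mathcal{H}_+$ if for every $D\in\mathcal{H}_+$ the function $\varphi\circ D$ on $\mathbb{C}_{\frac12}$ is given by a Dirichlet series belonging to $\mathcal{H}_+$. *)

theory Defs
  imports "HOL-Analysis.Analysis" "HOL-Computational_Algebra.Polynomial"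
begin

text \<open>A Dirichlet series $\sum_{n \ge 1} a_n n^{-s}$ is represented by its coefficient sequence
  \<open>a\<close>, where \<open>a n\<close> is the coefficient of $n^{-s}$; the value \<open>a 0\<close> plays no role.
  The sums below therefore run over \<open>Suc n\<close>.\<close>

definition dirichlet_term :: "(nat \<Rightarrow> complex) \<Rightarrow> complex \<Rightarrow> nat \<Rightarrow> complex" where
  "dirichlet_term a s n = a n * of_nat n powr (- s)"

definition dirichlet_series :: "(nat \<Rightarrow> complex) \<Rightarrow> complex \<Rightarrow> complex" where
  "dirichlet_series a s = (\<Sum>n. dirichlet_term a s (Suc n))"

definition right_half_plane :: "real \<Rightarrow> complex set" where
  "right_half_plane \<theta> = {s. Re s > \<theta>}"

definition H_plus :: "(nat \<Rightarrow> complex) set" where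
  "H_plus = {a. \<forall>\<sigma>::real. \<sigma> > 0 \<longrightarrow>
     summable (\<lambda>n. (cmod (a (Suc n)))\<^sup>2 * real (Suc n) powr (- 2 * \<sigma>))}"

text \<open>By the following lemma, the value of \<open>dirichlet_series\<close> is the sum of an absolutely
  convergent series whenever the coefficients are in \<open>H_plus\<close> and \<open>Re s > 1/2\<close>.\<close>

lemma H_plus_abs_convergent:
  assumes "a \<in> H_plus" and "s \<in> right_half_plane (1/2)"
  shows "summable (\<lambda>n. norm (dirichlet_term a s (Suc n)))"
proof -
  define \<epsilon> where "\<epsilon> = (Re s - 1/2) / 2"
  have eps: "\<epsilon> > 0" "Re s - \<epsilon> > 1/2"
    using assms(2) by (auto simp: \<epsilon>_def right_half_plane_def field_simps)
  have 1: "summable (\<lambda>n. (cmod (a (Suc n)))\<^sup>2 * real (Suc n) powr (- 2 * \<epsilon>))"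
    using assms(1) eps(1) unfolding H_plus_def by blast
  have "summable (\<lambda>n. real n powr (- 2 * (Re s - \<epsilon>)))"
    using eps(2) by (subst summable_real_powr_iff) auto
  then have 2: "summable (\<lambda>n. real (Suc n) powr (- 2 * (Re s - \<epsilon>)))"
    by (subst summable_Suc_iff)
  show ?thesis
  proof (rule summable_comparison_test'[OF summable_add[OF 1 2], where N = 0])
    fix n :: nat
    define x where "x = cmod (a (Suc n)) * real (Suc n) powr (- \<epsilon>)"
    define y where "y = real (Suc n) powr (- (Re s - \<epsilon>))"
    have sq: "(real (Suc n) powr t)\<^sup>2 = real (Suc n) powr (2 * t)" for t
      by (simp only: power2_eq_square powr_add [symmetric] mult_2)
    have "norm (of_nat (Suc n) powr (- s) :: complex) = real (Suc n) powr (- Re s)"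
      using norm_powr_real_powr[of "of_nat (Suc n)" "- s"] by simp
    then have "norm (dirichlet_term a s (Suc n)) = x * y"
      unfolding dirichlet_term_def norm_mult x_def y_def
      by (simp add: mult.assoc powr_add [symmetric] del: of_nat_Suc)
    also have "\<dots> \<le> x\<^sup>2 + y\<^sup>2"
    proof -
      have "x \<ge> 0" "y \<ge> 0" by (auto simp: x_def y_def)
      then have "x * y \<le> 2 * x * y" by simp
      also have "\<dots> \<le> x\<^sup>2 + y\<^sup>2" by (rule sum_squares_bound)
      finally show ?thesis .
    qed
    also have "\<dots> = (cmod (a (Suc n)))\<^sup>2 * real (Suc n) powr (- 2 * \<epsilon>)
                    + real (Suc n) powr (- 2 * (Re s - \<epsilon>))"
      unfolding x_def y_def power_mult_distrib sq by simp
    finally show "norm (norm (dirichlet_term a s (Suc n))) \<le>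
      (cmod (a (Suc n)))\<^sup>2 * real (Suc n) powr (- 2 * \<epsilon>)
       + real (Suc n) powr (- 2 * (Re s - \<epsilon>))"
      by simp
  qed
qed

definition superposition ::
  "(complex \<Rightarrow> complex) \<Rightarrow> (nat \<Rightarrow> complex) \<Rightarrow> complex \<Rightarrow> complex" where
  "superposition \<phi> a = \<phi> \<circ> dirichlet_series a"

text \<open>\<open>superposition \<phi> a\<close> is only meaningful on $\{\mathrm{Re}\, s > 1/2\}$, so the function it
  represents is compared with a Dirichlet series on that half-plane only.\<close>

definition superposition_well_defined :: "(complex \<Rightarrow> complex) \<Rightarrow> bool" where
  "superposition_well_defined \<phi> \<longleftrightarrow>
     (\<forall>a \<in> H_plus. \<exists>b \<in> H_plus. \<forall>s \<in> right_half_plane (1/2).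
        superposition \<phi> a s = dirichlet_series b s)"

end

theory Submission imports Defs
begin

text \<open>Polynomials are built from constants by addition and multiplication by $D$, so it suffices
  that \<open>H_plus\<close> is closed under Dirichlet convolution. By Cauchy--Schwarz,
  $|(a * b)_n|^2 \le \tau(n) \sum_{d \mid n} |a_d|^2 |b_{n/d}|^2$ with $\tau$ the number of divisors,
  and the divisor bound $\tau(n) = O(n^\sigma)$ absorbs $\tau(n)$ into half of the weight
  $n^{-2\sigma}$. The divisor bound itself follows without prime factorizations:
  $\sum_n \tau(n)^k n^{-2}$ converges for every $k$, because submultiplicativity of $\tau$ gives
  $\sum_n \tau(n)^{k+1} n^{-2} \le (\sum_n \tau(n)^k n^{-2})^2$.\<close>

section \<open>Dirichlet convolution of absolutely summable sequences\<close>

text \<open>The codomain is kept general because both complex coefficients and real majorants are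
  convolved. At \<open>n = 0\<close> every \<open>d\<close> divides \<open>n\<close>, the index set
  is infinite and the value is 0.\<close>

definition dirichlet_conv :: "(nat \<Rightarrow> 'a::semiring_0) \<Rightarrow> (nat \<Rightarrow> 'a) \<Rightarrow> nat \<Rightarrow> 'a" where
  "dirichlet_conv f g n = (\<Sum>d | d dvd n. f d * g (n div d))"

text \<open>The product of the two sums is a sum over all pairs \<open>(d, e)\<close>; absolute
  convergence allows it to be regrouped by the value of \<open>d * e\<close>.\<close>

lemma has_sum_dirichlet_conv:
  fixes f g :: "nat \<Rightarrow> 'a::{real_normed_field, banach}"
  assumes f: "(\<lambda>n. norm (f n)) summable_on {1..}" and g: "(\<lambda>n. norm (g n)) summable_on {1..}"
  shows "(dirichlet_conv f g has_sum (infsum f {1..} * infsum g {1..})) {1..}"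
proof -
  have fs: "(f has_sum infsum f {1..}) {1..}" and gs: "(g has_sum infsum g {1..}) {1..}"
    using f g by (blast intro: has_sum_infsum abs_summable_summable)+
  have "(\<lambda>p. norm (f (fst p) * g (snd p))) summable_on ({1..} \<times> {1..})"
  proof (rule summable_on_SigmaI)
    fix d :: nat
    show "((\<lambda>e. norm (f (fst (d, e)) * g (snd (d, e)))) has_sum
        (norm (f d) * (\<Sum>\<^sub>\<infinity>e\<in>{1..}. norm (g e)))) {1..}"
      using g by (auto simp: norm_mult intro!: has_sum_cmult_right)
  qed (use f in \<open>auto intro!: summable_on_cmult_left\<close>)
  then have "(\<lambda>p. f (fst p) * g (snd p)) summable_on ({1..} \<times> {1..})"
    by (rule abs_summable_summable)
  then have "((\<lambda>p. f (fst p) * g (snd p)) has_sum (infsum f {1..} * infsum g {1..}))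
      ({1..} \<times> {1..})"
    by (intro has_sum_SigmaI[where g = "\<lambda>d. f d * infsum g {1..}"])
       (auto intro!: has_sum_cmult_right has_sum_cmult_left fs gs simp del: One_nat_def)
  \<comment> \<open>A pair \<open>(d, e)\<close> is renamed \<open>(n, d)\<close> with
    \<open>n = d * e\<close>, so for fixed \<open>n\<close> the inner sum runs over the divisors of
    \<open>n\<close>.\<close>
  also have "?this \<longleftrightarrow> ((\<lambda>p. f (snd p) * g (fst p div snd p)) has_sum
      (infsum f {1..} * infsum g {1..})) (SIGMA n:{1..}. {d. d dvd n})"
    by (rule has_sum_reindex_bij_witness[where i = "\<lambda>(n, d). (d, n div d)"
          and j = "\<lambda>(d, e). (d * e, d)"]) (auto simp: Suc_le_eq dvd_div_eq_0_iff)
  finally show ?thesis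
    by (rule has_sum_SigmaD) (auto simp: dirichlet_conv_def intro!: has_sum_finiteI)
qed

lemma norm_dirichlet_conv_le:
  fixes f g :: "nat \<Rightarrow> 'a::real_normed_field"
  shows "norm (dirichlet_conv f g n) \<le> dirichlet_conv (\<lambda>n. norm (f n)) (\<lambda>n. norm (g n)) n"
  unfolding dirichlet_conv_def by (rule sum_norm_le) (simp add: norm_mult)

text \<open>Allows the series of a convolution to be rewritten later as an unordered sum. The
  convolution of the norms is a summable majorant.\<close>

lemma norm_summable_dirichlet_conv:
  fixes f g :: "nat \<Rightarrow> 'a::{real_normed_field, banach}"
  assumes "(\<lambda>n. norm (f n)) summable_on {1..}" and "(\<lambda>n. norm (g n)) summable_on {1..}"
  shows "(\<lambda>n. norm (dirichlet_conv f g n)) summable_on {1..}"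
proof (rule summable_on_comparison_test)
  show "dirichlet_conv (\<lambda>n. norm (f n)) (\<lambda>n. norm (g n)) summable_on {1..}"
    by (rule has_sum_imp_summable[OF has_sum_dirichlet_conv]) (use assms in auto)
qed (use norm_dirichlet_conv_le in auto)

text \<open>Links the shifted series of the definitions to unordered sums over \<open>{1..}\<close>;
  for nonnegative terms both kinds of summability agree.\<close>

lemma summable_Suc_iff_summable_on:
  fixes f :: "nat \<Rightarrow> real"
  assumes "\<And>n. f n \<ge> 0"
  shows "summable (\<lambda>n. f (Suc n)) \<longleftrightarrow> f summable_on {1..}"
proof -
  have "f summable_on {1..} \<longleftrightarrow> (\<lambda>n. f (Suc n)) summable_on UNIV"
    by (rule summable_on_reindex_bij_witness[where i = Suc and j = "\<lambda>n. n - 1"]) auto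
  then show ?thesis
    by (simp add: summable_on_UNIV_nonneg_real_iff assms)
qed

section \<open>The divisor bound\<close>

definition num_divisors :: "nat \<Rightarrow> nat" where
  "num_divisors n = card {d. d dvd n}"

text \<open>Every divisor of \<open>m * n\<close> is a divisor of \<open>m\<close> times a divisor
  of \<open>n\<close>, so multiplication maps the pairs of divisors onto a set containing all of
  them.\<close>

lemma num_divisors_mult_le:
  assumes "m > 0" "n > 0"
  shows "num_divisors (m * n) \<le> num_divisors m * num_divisors n"
proof -
  have "{d. d dvd m * n} \<subseteq> (\<lambda>(a, b). a * b) ` ({d. d dvd m} \<times> {d. d dvd n})"
  proof
    fix d assume "d \<in> {d. d dvd m * n}"
    then obtain a b where "d = a * b" "a dvd m" "b dvd n"
      using division_decomp by blast
    then show "d \<in> (\<lambda>(a, b). a * b) ` ({d. d dvd m} \<times> {d. d dvd n})"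
      by (intro image_eqI[of _ _ "(a, b)"]) auto
  qed
  then show ?thesis
    unfolding num_divisors_def card_cartesian_product[symmetric]
    using assms by (intro surj_card_le) auto
qed

lemma summable_num_divisors_power:
  "(\<lambda>n. real (num_divisors n) ^ k / real n ^ 2) summable_on {1..}"
proof (induction k)
  case 0
  have "summable (\<lambda>n. 1 / real (Suc n) ^ 2)"
    using inverse_power_summable[of 2, where 'a = real]
    by (subst summable_Suc_iff) (simp add: divide_inverse)
  then show ?case
    by (subst (asm) summable_Suc_iff_summable_on) auto
next
  case (Suc k)
  let ?f = "\<lambda>n. real (num_divisors n) ^ k / real n ^ 2"
  have "dirichlet_conv ?f ?f summable_on {1..}"
    by (rule has_sum_imp_summable[OF has_sum_dirichlet_conv]) (use Suc in auto)
  then show ?case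
  proof (rule summable_on_comparison_test)
    fix n :: nat assume "n \<in> {1..}"
    then have n: "n > 0" by simp
    \<comment> \<open>One factor \<open>num_divisors n\<close> becomes the number of terms of a
      constant sum over divisors. The other \<open>k\<close> factors split by submultiplicativity,
      and the denominator splits exactly.\<close>
    have "real (num_divisors n) ^ Suc k / real n ^ 2 = (\<Sum>d | d dvd n. ?f n)"
      by (simp add: num_divisors_def)
    also have "\<dots> \<le> (\<Sum>d | d dvd n. ?f d * ?f (n div d))"
    proof (rule sum_mono)
      fix d assume "d \<in> {d. d dvd n}"
      then obtain e where ne: "n = d * e" by auto
      with n have de: "d > 0" "e > 0" by auto
      have "real (num_divisors n) ^ k \<le> (real (num_divisors d) * real (num_divisors e)) ^ k"
        using num_divisors_mult_le[OF de] unfolding ne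
        by (intro power_mono) (simp_all flip: of_nat_mult)
      then have "?f n \<le> (real (num_divisors d) * real (num_divisors e)) ^ k / real n ^ 2"
        by (rule divide_right_mono) simp
      also have "\<dots> = ?f d * ?f (n div d)"
        using de by (simp add: ne power_mult_distrib)
      finally show "?f n \<le> ?f d * ?f (n div d)" .
    qed
    finally show "real (num_divisors n) ^ Suc k / real n ^ 2 \<le> dirichlet_conv ?f ?f n"
      by (simp add: dirichlet_conv_def)
  qed simp
qed

lemma num_divisors_bound:
  assumes "\<epsilon> > 0"
  obtains C where "C \<ge> 0" "\<And>n. n > 0 \<Longrightarrow> real (num_divisors n) \<le> C * real n powr \<epsilon>"
proof -
  \<comment> \<open>Taking a \<open>k\<close>-th root of a bound of order \<open>n^2\<close> leaves
    the exponent \<open>2 / k\<close>, which has to be at most \<open>\<epsilon>\<close>.\<close>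
  obtain k :: nat where k2: "2 / \<epsilon> \<le> real k"
    using real_arch_simple by blast
  moreover have "2 / \<epsilon> > 0" using assms by simp
  ultimately have "real k > 0" by linarith
  then have k: "k > 0" by simp
  define M where "M = (\<Sum>\<^sub>\<infinity>n\<in>{1..}. real (num_divisors n) ^ k / real n ^ 2)"
  have M: "M \<ge> 0" unfolding M_def by (rule infsum_nonneg) auto
  have "real (num_divisors n) \<le> root k M * real n powr \<epsilon>" if n: "n > 0" for n
  proof (rule power_le_imp_le_base)
    \<comment> \<open>A single term of a convergent nonnegative series is bounded by its sum
      \<open>M\<close>.\<close>
    have "(\<Sum>m\<in>{n}. real (num_divisors m) ^ k / real m ^ 2) \<le> M"
      unfolding M_def using n
      by (intro finite_sum_le_infsum summable_num_divisors_power) auto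
    then have "real (num_divisors n) ^ k \<le> M * real n ^ 2"
      using n by (simp add: field_simps)
    also have "\<dots> = M * real n powr 2"
      using n by (simp add: powr_numeral)
    also have "\<dots> \<le> M * real n powr (real k * \<epsilon>)"
      using n M k2 assms by (intro mult_left_mono powr_mono) (auto simp: field_simps)
    also have "\<dots> = (root k M * real n powr \<epsilon>) ^ k"
      using k n M by (simp add: power_mult_distrib powr_power mult.commute)
    finally show "real (num_divisors n) ^ Suc (k - 1) \<le> (root k M * real n powr \<epsilon>) ^ Suc (k - 1)"
      using k by simp
  qed (use M k in simp)
  then show ?thesis using M k by (intro that[of "root k M"]) auto
qed

section \<open>Closure properties of \<open>H_plus\<close>\<close>

lemma H_plus_iff:
  "a \<in> H_plus \<longleftrightarrow>
     (\<forall>\<sigma>>0. (\<lambda>n. (cmod (a n))\<^sup>2 * real n powr (- 2 * \<sigma>)) summable_on {1..})"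
  unfolding H_plus_def mem_Collect_eq
  by (subst summable_Suc_iff_summable_on
        [where f = "\<lambda>n. (cmod (a n))\<^sup>2 * real n powr (- 2 * \<sigma>)" for \<sigma>]) auto

lemma H_plus_add:
  assumes "a \<in> H_plus" "b \<in> H_plus"
  shows "(\<lambda>n. a n + b n) \<in> H_plus"
  unfolding H_plus_iff
proof (intro allI impI)
  fix \<sigma> :: real assume \<sigma>: "\<sigma> > 0"
  let ?w = "\<lambda>n. real n powr (- 2 * \<sigma>)"
  have "(\<lambda>n. 2 * ((cmod (a n))\<^sup>2 * ?w n) + 2 * ((cmod (b n))\<^sup>2 * ?w n)) summable_on {1..}"
    using assms \<sigma> unfolding H_plus_iff by (intro summable_on_add summable_on_cmult_right) auto
  then show "(\<lambda>n. (cmod (a n + b n))\<^sup>2 * ?w n) summable_on {1..}"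
  proof (rule summable_on_comparison_test)
    fix n
    have "(cmod (a n + b n))\<^sup>2 \<le> (cmod (a n) + cmod (b n))\<^sup>2"
      by (intro power_mono norm_triangle_ineq) auto
    also have "\<dots> \<le> 2 * (cmod (a n))\<^sup>2 + 2 * (cmod (b n))\<^sup>2"
      using sum_squares_bound[of "cmod (a n)" "cmod (b n)"] by (simp add: power2_sum)
    finally have "(cmod (a n + b n))\<^sup>2 * ?w n \<le> (2 * (cmod (a n))\<^sup>2 + 2 * (cmod (b n))\<^sup>2) * ?w n"
      by (rule mult_right_mono) simp
    then show "(cmod (a n + b n))\<^sup>2 * ?w n
        \<le> 2 * ((cmod (a n))\<^sup>2 * ?w n) + 2 * ((cmod (b n))\<^sup>2 * ?w n)"
      by (simp add: algebra_simps)
  qed simp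
qed

lemma H_plus_dirichlet_conv:
  assumes "a \<in> H_plus" "b \<in> H_plus"
  shows "dirichlet_conv a b \<in> H_plus"
  unfolding H_plus_iff
proof (intro allI impI)
  fix \<sigma> :: real assume \<sigma>: "\<sigma> > 0"
  \<comment> \<open>This is the \<open>H_plus\<close> weight at \<open>\<sigma> / 2\<close>. The
    other half of the target weight is left to cancel the divisor bound.\<close>
  define u where "u a n = (cmod (a n))\<^sup>2 * real n powr (- \<sigma>)" for a :: "nat \<Rightarrow> complex" and n
  obtain C where C: "C \<ge> 0" "\<And>n. n > 0 \<Longrightarrow> real (num_divisors n) \<le> C * real n powr \<sigma>"
    using num_divisors_bound[OF \<sigma>] by blast
  have u: "u a summable_on {1..}" if "a \<in> H_plus" for a
    using that \<sigma> unfolding H_plus_iff u_def by (auto dest: spec[of _ "\<sigma> / 2"])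
  have u_nonneg: "u a n \<ge> 0" for a n by (simp add: u_def)
  have "dirichlet_conv (u a) (u b) summable_on {1..}"
    by (rule has_sum_imp_summable[OF has_sum_dirichlet_conv])
       (use u[OF assms(1)] u[OF assms(2)] in \<open>simp_all add: u_nonneg\<close>)
  then have "(\<lambda>n. C * dirichlet_conv (u a) (u b) n) summable_on {1..}"
    by (rule summable_on_cmult_right)
  then show "(\<lambda>n. (cmod (dirichlet_conv a b n))\<^sup>2 * real n powr (- 2 * \<sigma>)) summable_on {1..}"
  proof (rule summable_on_comparison_test)
    fix n :: nat assume "n \<in> {1..}"
    then have n: "n > 0" by simp
    define S where "S = (\<Sum>d | d dvd n. (cmod (a d) * cmod (b (n div d)))\<^sup>2)"
    have S: "S \<ge> 0" unfolding S_def by (intro sum_nonneg) simp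
    have "(cmod (dirichlet_conv a b n))\<^sup>2 \<le> (\<Sum>d | d dvd n. cmod (a d) * cmod (b (n div d)))\<^sup>2"
      using norm_dirichlet_conv_le[of a b n] unfolding dirichlet_conv_def
      by (intro power_mono) auto
    \<comment> \<open>Cauchy-Schwarz against the constant 1 on the divisors of
      \<open>n\<close>.\<close>
    also have "\<dots> \<le> S * real (num_divisors n)"
      unfolding S_def num_divisors_def by (rule sum_squared_le_sum_of_squares)
    also have "\<dots> \<le> S * (C * real n powr \<sigma>)"
      using C(2)[OF n] S by (rule mult_left_mono)
    finally have "(cmod (dirichlet_conv a b n))\<^sup>2 * real n powr (- 2 * \<sigma>)
        \<le> S * (C * real n powr \<sigma>) * real n powr (- 2 * \<sigma>)"
      by (rule mult_right_mono) simp
    also have "\<dots> = C * (S * (real n powr \<sigma> * real n powr (- 2 * \<sigma>)))"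
      by (simp add: mult_ac)
    also have "\<dots> = C * (S * real n powr (- \<sigma>))"
      by (simp add: powr_add[symmetric])
    \<comment> \<open>The weight is completely multiplicative, so it distributes over the factors
      \<open>d\<close> and \<open>n div d\<close> in each summand of \<open>S\<close>.\<close>
    also have "S * real n powr (- \<sigma>) = dirichlet_conv (u a) (u b) n"
      unfolding S_def dirichlet_conv_def u_def sum_distrib_right
    proof (rule sum.cong[OF refl])
      fix d assume "d \<in> {d. d dvd n}"
      then have "real n = real d * real (n div d)"
        by (simp flip: of_nat_mult)
      then have "real n powr (- \<sigma>) = real d powr (- \<sigma>) * real (n div d) powr (- \<sigma>)"
        by (simp only: powr_mult)
      then show "(cmod (a d) * cmod (b (n div d)))\<^sup>2 * real n powr (- \<sigma>) =
          (cmod (a d))\<^sup>2 * real d powr (- \<sigma>) *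
          ((cmod (b (n div d)))\<^sup>2 * real (n div d) powr (- \<sigma>))"
        by (simp add: power_mult_distrib)
    qed
    finally show "(cmod (dirichlet_conv a b n))\<^sup>2 * real n powr (- 2 * \<sigma>)
        \<le> C * dirichlet_conv (u a) (u b) n" .
  qed simp
qed

text \<open>Supplies the zero series and the constant series for the induction on the
  polynomial.\<close>

lemma H_plus_finite_support:
  assumes "finite {n. a n \<noteq> 0}"
  shows "a \<in> H_plus"
  unfolding H_plus_iff
proof (intro allI impI)
  fix \<sigma> :: real
  show "(\<lambda>n. (cmod (a n))\<^sup>2 * real n powr (- 2 * \<sigma>)) summable_on {1..}"
    by (rule finite_nonzero_values_imp_summable_on, rule finite_subset[OF _ assms]) auto
qed

section \<open>Values of Dirichlet series\<close>

lemma H_plus_abs_summable_on: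
  assumes "a \<in> H_plus" "s \<in> right_half_plane (1/2)"
  shows "(\<lambda>n. norm (dirichlet_term a s n)) summable_on {1..}"
  using H_plus_abs_convergent[OF assms] by (subst (asm) summable_Suc_iff_summable_on) auto

lemma dirichlet_series_eq_infsum:
  assumes "(\<lambda>n. norm (dirichlet_term a s n)) summable_on {1..}"
  shows "dirichlet_series a s = (\<Sum>\<^sub>\<infinity>n\<in>{1..}. dirichlet_term a s n)"
proof -
  have "(dirichlet_term a s has_sum (\<Sum>\<^sub>\<infinity>n\<in>{1..}. dirichlet_term a s n)) {1..}"
    using assms by (blast intro: has_sum_infsum abs_summable_summable)
  also have "?this \<longleftrightarrow> ((\<lambda>n. dirichlet_term a s (Suc n)) has_sum
      (\<Sum>\<^sub>\<infinity>n\<in>{1..}. dirichlet_term a s n)) UNIV"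
    by (rule has_sum_reindex_bij_witness[where i = Suc and j = "\<lambda>n. n - 1"]) auto
  finally show ?thesis
    unfolding dirichlet_series_def by (intro sums_unique[symmetric] has_sum_imp_sums)
qed

lemma dirichlet_term_conv:
  "dirichlet_term (dirichlet_conv a b) s n
     = dirichlet_conv (dirichlet_term a s) (dirichlet_term b s) n"
  unfolding dirichlet_conv_def dirichlet_term_def sum_distrib_right
proof (rule sum.cong[OF refl])
  fix d assume "d \<in> {d. d dvd n}"
  then have "(of_nat n :: complex) = of_nat d * of_nat (n div d)"
    by (simp flip: of_nat_mult)
  \<comment> \<open>Complex powers are not multiplicative in the base in general, because of the
    branch of the logarithm; they are for nonnegative real bases, as here.\<close>
  then have "(of_nat n :: complex) powr (- s) = of_nat d powr (- s) * of_nat (n div d) powr (- s)"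
    by (simp only: powr_times_real Reals_of_nat complex_Re_of_nat of_nat_0_le_iff)
  then show "a d * b (n div d) * of_nat n powr (- s) =
      a d * of_nat d powr (- s) * (b (n div d) * of_nat (n div d) powr (- s))"
    by simp
qed

lemma dirichlet_series_conv:
  assumes "a \<in> H_plus" "b \<in> H_plus" "s \<in> right_half_plane (1/2)"
  shows "dirichlet_series (dirichlet_conv a b) s = dirichlet_series a s * dirichlet_series b s"
proof -
  note sa = H_plus_abs_summable_on[OF assms(1,3)] and sb = H_plus_abs_summable_on[OF assms(2,3)]
  have term_eq: "dirichlet_term (dirichlet_conv a b) s
      = dirichlet_conv (dirichlet_term a s) (dirichlet_term b s)"
    by (rule ext) (rule dirichlet_term_conv)
  show ?thesis
    using infsumI[OF has_sum_dirichlet_conv[OF sa sb]] norm_summable_dirichlet_conv[OF sa sb]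
    by (simp add: dirichlet_series_eq_infsum sa sb term_eq del: One_nat_def)
qed

lemma dirichlet_series_add:
  assumes "a \<in> H_plus" "b \<in> H_plus" "s \<in> right_half_plane (1/2)"
  shows "dirichlet_series (\<lambda>n. a n + b n) s = dirichlet_series a s + dirichlet_series b s"
  using suminf_add[OF summable_norm_cancel[OF H_plus_abs_convergent[OF assms(1,3)]]
      summable_norm_cancel[OF H_plus_abs_convergent[OF assms(2,3)]]]
  by (simp add: dirichlet_series_def dirichlet_term_def distrib_right)

lemma dirichlet_series_const:
  "dirichlet_series (\<lambda>n. if n = 1 then c else 0) s = c"
proof -
  have "(\<lambda>n. dirichlet_term (\<lambda>n. if n = 1 then c else 0) s (Suc n)) = (\<lambda>n. if n = 0 then c else 0)"
    by (auto simp: dirichlet_term_def fun_eq_iff)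
  then show ?thesis
    by (simp add: dirichlet_series_def sums_unique[OF sums_single, symmetric])
qed

text \<open>Induction along Horner's scheme: if \<open>b\<close> serves for \<open>p\<close>, then
  the constant series \<open>c\<close> plus the convolution of \<open>a\<close> and \<open>b\<close>
  serves for \<open>pCons c p\<close>. The witness does not depend on \<open>s\<close>.\<close>

lemma poly_dirichlet_series:
  assumes a: "a \<in> H_plus"
  shows "\<exists>b\<in>H_plus. \<forall>s\<in>right_half_plane (1/2). poly p (dirichlet_series a s) = dirichlet_series b s"
proof (induction p)
  case 0
  show ?case
    by (rule bexI[where x = "\<lambda>_. 0"])
       (auto simp: dirichlet_series_def dirichlet_term_def intro: H_plus_finite_support)
next
  case (pCons c p)
  then obtain b where b: "b \<in> H_plus"
    "\<And>s. s \<in> right_half_plane (1/2) \<Longrightarrow> poly p (dirichlet_series a s) = dirichlet_series b s"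
    by blast
  let ?c = "\<lambda>n. if n = 1 then c else 0"
  have c: "?c \<in> H_plus" by (rule H_plus_finite_support) simp
  note ab = H_plus_dirichlet_conv[OF a b(1)]
  show ?case
    by (rule bexI[OF _ H_plus_add[OF c ab]])
       (simp add: dirichlet_series_add[OF c ab] dirichlet_series_conv[OF a b(1)]
          dirichlet_series_const b(2) del: One_nat_def)
qed

theorem corollary5p4:
  fixes \<phi> :: "complex \<Rightarrow> complex"
  assumes "\<exists>p :: complex poly. \<phi> = poly p"
  shows "superposition_well_defined \<phi>"
  using assms poly_dirichlet_series
  unfolding superposition_well_defined_def superposition_def by auto

end
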